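(* Let $\hat S\in\mathcal S$ be a follower solution. Then the basic submodular interdiction cut $$w\ \ge\ z(\hat S)-\sum_{i\in\hat S}\rho_i(\emptyset)\,x_i$$ is valid for the single-level model $\min\{w : w\ge \Phi(x),\ Ax\le b,\ x\in\{0,1\}^n\}$; that is, every pair $(x,w)$ with $x\in X$, $w\in\mathbb R$ and $w\ge\Phi(x)$ satisfies this inequality.
   Context: $N$ is a finite ground set of items and $z:2^N\to\mathbb R$ is a set function that is submodular ($z(S\cup\{i\})-z(S)\ge z(T\cup\{i\})-z(T)$ for all $S\subseteq T\subseteq N$, $i\in N\setminus T$) and non-decreasing ($z(S)\le z(T)$ for $S\subseteq T\subseteq N$). The marginal gain of $i\in N$ with respect to $S\subseteq N$ is $\rho_i(S)=z(S\cup\{i\})-z(S)$. Leader: $X=\{x\in\{0,1\}^n: Ax\le b\}$, where $A$ is a real matrix and $b$ a real vector of appropriate dimensions, and $n$ is the number of leader variables; there is a leader variable $x_i$ for every item $i\in N$. For $x\in X$, $N_x=\{i\in N: x_i=1\}$ is the set of interdicted items. Follower: for $\ell=1,\dots,L$ and $i\in N$ there are costs $c_i^\ell\ge 0$ and budgets $Q_\ell\in\mathbb R$; write $C(S)\le Q$ if $\sum_{i\in S}c_i^\ell\le Q_\ell$ for all $\ell=1,\dots,L$. The set of follower solutions is $\mathcal S=\{S\subseteq N: C(S)\le Q\}$. The follower's value function is $\Phi(x)=\max\{z(S): S\subseteq N\setminus N_x,\ C(S)\le Q\}$. *)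

theory Defs
  imports "HOL-Analysis.Analysis"
begin

text \<open>Set functions on a ground set \<open>N\<close> are total functions on sets; only their values on
  subsets of \<open>N\<close> are ever constrained or used.\<close>

definition submodular_on :: "'a set \<Rightarrow> ('a set \<Rightarrow> real) \<Rightarrow> bool" where
  "submodular_on N z \<longleftrightarrow>
     (\<forall>S T i. S \<subseteq> T \<and> T \<subseteq> N \<and> i \<in> N - T \<longrightarrow> z (S \<union> {i}) - z S \<ge> z (T \<union> {i}) - z T)"

definition nondecreasing_on :: "'a set \<Rightarrow> ('a set \<Rightarrow> real) \<Rightarrow> bool" where
  "nondecreasing_on N z \<longleftrightarrow> (\<forall>S T. S \<subseteq> T \<and> T \<subseteq> N \<longrightarrow> z S \<le> z T)"

definition marginal_gain :: "('a set \<Rightarrow> real) \<Rightarrow> 'a \<Rightarrow> 'a set \<Rightarrow> real" where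
  "marginal_gain z i S = z (S \<union> {i}) - z S"

text \<open>The leader variables are indexed by the finite type \<open>'n\<close>. The items form a subset \<open>N\<close> of
  this index type, so that item \<open>i\<close> has the leader variable \<open>x $ i\<close>; there may be further leader
  variables that belong to no item. The order on vectors is componentwise.\<close>

definition leader_set :: "real ^ 'n ^ 'm \<Rightarrow> real ^ 'm \<Rightarrow> (real ^ 'n) set" where
  "leader_set A b = {x. (\<forall>j. x $ j \<in> {0, 1}) \<and> A *v x \<le> b}"

definition interdicted :: "'n set \<Rightarrow> real ^ 'n \<Rightarrow> 'n set" where
  "interdicted N x = {i \<in> N. x $ i = 1}"

definition within_budget :: "nat \<Rightarrow> (nat \<Rightarrow> 'a \<Rightarrow> real) \<Rightarrow> (nat \<Rightarrow> real) \<Rightarrow> 'a set \<Rightarrow> bool" where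
  "within_budget L c Q S \<longleftrightarrow> (\<forall>l\<in>{1..L}. (\<Sum>i\<in>S. c l i) \<le> Q l)"

definition follower_solutions ::
    "'a set \<Rightarrow> nat \<Rightarrow> (nat \<Rightarrow> 'a \<Rightarrow> real) \<Rightarrow> (nat \<Rightarrow> real) \<Rightarrow> 'a set set" where
  "follower_solutions N L c Q = {S. S \<subseteq> N \<and> within_budget L c Q S}"

text \<open>The maximum ranges over a finite set, which is nonempty as soon as some follower solution
  exists and the costs are nonnegative: the budgets are then nonnegative and the empty set is
  feasible for every \<open>x\<close>.\<close>

definition follower_value ::
    "'n set \<Rightarrow> ('n set \<Rightarrow> real) \<Rightarrow> nat \<Rightarrow> (nat \<Rightarrow> 'n \<Rightarrow> real) \<Rightarrow> (nat \<Rightarrow> real) \<Rightarrow> real ^ 'n \<Rightarrow> real" where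
  "follower_value N z L c Q x =
     Max {z S | S. S \<subseteq> N - interdicted N x \<and> within_budget L c Q S}"

definition single_level_feasible ::
    "real ^ 'n ^ 'm \<Rightarrow> real ^ 'm \<Rightarrow> 'n set \<Rightarrow> ('n set \<Rightarrow> real) \<Rightarrow> nat \<Rightarrow> (nat \<Rightarrow> 'n \<Rightarrow> real) \<Rightarrow>
     (nat \<Rightarrow> real) \<Rightarrow> ((real ^ 'n) \<times> real) set" where
  "single_level_feasible A b N z L c Q =
     {(x, w). x \<in> leader_set A b \<and> w \<ge> follower_value N z L c Q x}"

end

theory Submission
  imports Defs
begin

text \<open>
  Against an interdiction \<open>x\<close> the follower can always fall back on the part of \<open>S_hat\<close> that
  survives it: as costs are nonnegative, shrinking \<open>S_hat\<close> keeps it within the budgets, so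
  \<open>z (S_hat - interdicted N x)\<close> is a lower bound on the follower's value
  (\<open>follower_value_ge\<close>, \<open>within_budget_subset\<close>). The loss from \<open>S_hat\<close> to its surviving part is
  the gain of adding the interdicted items back one at a time; by diminishing returns each such
  gain is at most the gain of that item over the empty set (\<open>submodular_gain_le_sum\<close>). As \<open>x\<close> is
  binary, the coefficients \<open>x $ i\<close> select exactly the interdicted items, so the
  sum of these gains is the term subtracted in the cut.
\<close>

text \<open>Each item of \<open>T\<close> enters when a superset of \<open>R\<close> is already present. Measuring the gains at a
  common base \<open>R\<close> rather than at \<open>S\<close> itself lets \<open>R\<close> be empty in the cut.\<close>

lemma submodular_gain_le_sum:
  assumes "submodular_on N z" and "finite T"
    and "R \<subseteq> S" and "S \<union> T \<subseteq> N" and "S \<inter> T = {}"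
  shows "z (S \<union> T) - z S \<le> (\<Sum>i\<in>T. marginal_gain z i R)"
  using assms(2,4,5)
proof (induction T rule: finite_induct)
  case empty
  then show ?case by simp
next
  case (insert i T)
  have "z (S \<union> T \<union> {i}) - z (S \<union> T) \<le> z (R \<union> {i}) - z R"
  proof -
    have "R \<subseteq> S \<union> T \<and> S \<union> T \<subseteq> N \<and> i \<in> N - (S \<union> T)"
      using assms(3) insert by auto
    then show ?thesis
      using assms(1) unfolding submodular_on_def by blast
  qed
  moreover have "z (S \<union> T) - z S \<le> (\<Sum>j\<in>T. marginal_gain z j R)"
    using insert by auto
  ultimately show ?case
    using insert.hyps by (simp add: marginal_gain_def)
qed

lemma within_budget_subset:
  assumes "\<And>l i. l \<in> {1..L} \<Longrightarrow> i \<in> S \<Longrightarrow> c l i \<ge> 0"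
    and "finite S" and "T \<subseteq> S" and "within_budget L c Q S"
  shows "within_budget L c Q T"
  unfolding within_budget_def
proof
  fix l assume l: "l \<in> {1..L}"
  have "(\<Sum>i\<in>T. c l i) \<le> (\<Sum>i\<in>S. c l i)"
    using assms(1)[OF l] assms(2,3) by (intro sum_mono2) auto
  also have "\<dots> \<le> Q l"
    using assms(4) l by (simp add: within_budget_def)
  finally show "(\<Sum>i\<in>T. c l i) \<le> Q l" .
qed

lemma follower_value_ge:
  fixes N :: "'n::finite set"
  assumes "S \<subseteq> N - interdicted N x" and "within_budget L c Q S"
  shows "z S \<le> follower_value N z L c Q x"
  unfolding follower_value_def using assms by (intro Max_ge) auto

lemma sum_leader_eq_sum_interdicted:
  assumes "x \<in> leader_set A b" and "finite S" and "S \<subseteq> N"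
  shows "(\<Sum>i\<in>S. f i * x $ i) = (\<Sum>i\<in>S \<inter> interdicted N x. f i)"
proof -
  have "x $ i = 0 \<or> x $ i = 1" for i
    using assms(1) by (auto simp: leader_set_def)
  then have "(\<Sum>i\<in>S. f i * x $ i) = (\<Sum>i\<in>S. if i \<in> interdicted N x then f i else 0)"
    using assms(3) by (intro sum.cong refl) (fastforce simp: interdicted_def)
  then show ?thesis
    using assms(2) by (simp add: sum.inter_restrict)
qed

theorem theorem1:
  fixes N :: "'n::finite set"
    and z :: "'n set \<Rightarrow> real"
    and A :: "real ^ 'n ^ 'm::finite"
    and b :: "real ^ 'm"
    and L :: nat
    and c :: "nat \<Rightarrow> 'n \<Rightarrow> real"
    and Q :: "nat \<Rightarrow> real"
    and S_hat :: "'n set"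
  assumes "submodular_on N z"
    and "nondecreasing_on N z"
    and "\<And>l i. l \<in> {1..L} \<Longrightarrow> i \<in> N \<Longrightarrow> c l i \<ge> 0"
    and "S_hat \<in> follower_solutions N L c Q"
  shows "\<forall>(x, w) \<in> single_level_feasible A b N z L c Q.
           w \<ge> z S_hat - (\<Sum>i\<in>S_hat. marginal_gain z i {} * x $ i)"
proof (intro ballI, clarify)
  fix x w
  assume "(x, w) \<in> single_level_feasible A b N z L c Q"
  then have x: "x \<in> leader_set A b" and w: "follower_value N z L c Q x \<le> w"
    by (auto simp: single_level_feasible_def)
  have sub: "S_hat \<subseteq> N" and budget: "within_budget L c Q S_hat"
    using assms(4) by (auto simp: follower_solutions_def)
  define I where "I = interdicted N x"
  have "z (S_hat - I) \<le> follower_value N z L c Q x"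
  proof (rule follower_value_ge)
    show "S_hat - I \<subseteq> N - interdicted N x"
      using sub by (auto simp: I_def)
    show "within_budget L c Q (S_hat - I)"
      by (rule within_budget_subset[OF _ _ _ budget]) (use assms(3) sub in auto)
  qed
  moreover have "z S_hat - z (S_hat - I) \<le> (\<Sum>i\<in>S_hat \<inter> I. marginal_gain z i {})"
  proof -
    have "S_hat - I \<union> S_hat \<inter> I = S_hat"
      by blast
    moreover have "S_hat - I \<union> S_hat \<inter> I \<subseteq> N" "(S_hat - I) \<inter> (S_hat \<inter> I) = {}"
      using sub by auto
    ultimately show ?thesis
      using submodular_gain_le_sum[OF assms(1), of "S_hat \<inter> I" "{}" "S_hat - I"] by simp
  qed
  moreover have "(\<Sum>i\<in>S_hat. marginal_gain z i {} * x $ i)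
      = (\<Sum>i\<in>S_hat \<inter> I. marginal_gain z i {})"
    unfolding I_def by (rule sum_leader_eq_sum_interdicted[OF x _ sub]) simp
  ultimately show "z S_hat - (\<Sum>i\<in>S_hat. marginal_gain z i {} * x $ i) \<le> w"
    using w by linarith
qed

end
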